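(* Let $G=(V,E)$ be a connected graph, let $\widehat G=(V,E\cup F)$ with $F\subseteq\binom{V}{2}\setminus E$, and let $e\in E\cup F$. If $e\in E$, then the inequality $0\le x_e$ defines a facet of $\mathrm{LMC}(G,\widehat G)$ if and only if no triangle of $\widehat G$ contains $e$. If $e=uv\in F$, then $0\le x_e$ defines a facet of $\mathrm{LMC}(G,\widehat G)$ only if all of the following hold: (i) no triangle of $\widehat G$ contains $e$; (ii) for any two distinct $uv$-cut-nodes $s,t$ with $\{s,t\}\neq\{u,v\}$, the distance between $s$ and $t$ in $\widehat G$ is at least $3$; (iii) there is no triangle in $\widehat G$ with nodes $s,s',t$ such that $\{s,s'\}$ is a $uv$-separating node set and $t$ is a $uv$-cut-node.
   Context: Graphs are finite, simple, undirected; $uv$ denotes $\{u,v\}$. A set $S\subseteq V$ is $uv$-separating (with respect to $G$) if every $uv$-path in $G$ contains at least one node of $S$; a node $w$ is a $uv$-cut-node if $\{w\}$ is $uv$-separating. A decomposition of $G$ is a partition $\Pi$ of $V$ such that each block induces a connected subgraph of $G$; the multicut of $\widehat G$ lifted from $G$ induced by $\Pi$ is the set of edges of $E\cup F$ whose endpoints lie in distinct blocks of $\Pi$. $\mathrm{LMC}(G,\widehat G)\subseteq\mathbb{R}^{E\cup F}$ is the convex hull of the characteristic vectors of all multicuts of $\widehat G$ lifted from $G$. *)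

theory Defs
  imports "HOL-Analysis.Analysis" "HOL-Library.Ramsey" "HOL-Library.Extended_Nat"
    "HOL-Library.Disjoint_Sets"
begin

definition simple_graph :: "'v set \<Rightarrow> 'v set set \<Rightarrow> bool" where
  "simple_graph V E \<longleftrightarrow> finite V \<and> E \<subseteq> nsets V 2"

definition is_path :: "'v set \<Rightarrow> 'v set set \<Rightarrow> 'v \<Rightarrow> 'v \<Rightarrow> 'v list \<Rightarrow> bool" where
  "is_path V E u v p \<longleftrightarrow>
     p \<noteq> [] \<and> distinct p \<and> set p \<subseteq> V \<and> hd p = u \<and> last p = v \<and>
     successively (\<lambda>a b. {a, b} \<in> E) p"

definition connected_graph :: "'v set \<Rightarrow> 'v set set \<Rightarrow> bool" where
  "connected_graph V E \<longleftrightarrow> V \<noteq> {} \<and> (\<forall>u\<in>V. \<forall>v\<in>V. \<exists>p. is_path V E u v p)"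

definition induced_edges :: "'v set set \<Rightarrow> 'v set \<Rightarrow> 'v set set" where
  "induced_edges E U = {e \<in> E. e \<subseteq> U}"

text \<open>The distance is \<open>\<infinity>\<close> if there is no path (infimum of the empty set).\<close>

definition graph_dist :: "'v set \<Rightarrow> 'v set set \<Rightarrow> 'v \<Rightarrow> 'v \<Rightarrow> enat" where
  "graph_dist V E u v = Inf {enat (length p - 1) | p. is_path V E u v p}"

definition is_triangle :: "'v set set \<Rightarrow> 'v \<Rightarrow> 'v \<Rightarrow> 'v \<Rightarrow> bool" where
  "is_triangle E a b c \<longleftrightarrow> a \<noteq> b \<and> b \<noteq> c \<and> a \<noteq> c \<and> {a, b} \<in> E \<and> {b, c} \<in> E \<and> {a, c} \<in> E"

definition in_triangle :: "'v set set \<Rightarrow> 'v set \<Rightarrow> bool" where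
  "in_triangle E e \<longleftrightarrow> (\<exists>a b c. is_triangle E a b c \<and> e \<in> {{a, b}, {b, c}, {a, c}})"

text \<open>The end nodes \<open>u\<close> and \<open>v\<close> lie on every \<open>uv\<close>-path, so they are themselves \<open>uv\<close>-cut-nodes.\<close>

definition separating :: "'v set \<Rightarrow> 'v set set \<Rightarrow> 'v \<Rightarrow> 'v \<Rightarrow> 'v set \<Rightarrow> bool" where
  "separating V E u v S \<longleftrightarrow> S \<subseteq> V \<and> (\<forall>p. is_path V E u v p \<longrightarrow> set p \<inter> S \<noteq> {})"

definition cut_node :: "'v set \<Rightarrow> 'v set set \<Rightarrow> 'v \<Rightarrow> 'v \<Rightarrow> 'v \<Rightarrow> bool" where
  "cut_node V E u v w \<longleftrightarrow> separating V E u v {w}"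

definition decomposition :: "'v set \<Rightarrow> 'v set set \<Rightarrow> 'v set set \<Rightarrow> bool" where
  "decomposition V E \<P> \<longleftrightarrow>
     partition_on V \<P> \<and> (\<forall>B\<in>\<P>. connected_graph B (induced_edges E B))"

definition multicut :: "'v set set \<Rightarrow> 'v set set \<Rightarrow> 'v set set" where
  "multicut E' \<P> = {e \<in> E'. \<exists>a b A B. e = {a, b} \<and> A \<in> \<P> \<and> B \<in> \<P> \<and> A \<noteq> B \<and> a \<in> A \<and> b \<in> B}"

text \<open>
  The space of real vectors indexed by \<open>E \<union> F\<close> is realised as the coordinate subspace of
  \<^typ>\<open>real ^ 'v set\<close> whose coordinates at sets that are not in \<open>E \<union> F\<close> vanish.
  Faces and affine dimensions do not depend on this embedding.
\<close>

definition char_vec :: "'v::finite set set \<Rightarrow> real ^ 'v set" where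
  "char_vec M = (\<chi> e. indicator M e)"

definition LMC :: "'v::finite set \<Rightarrow> 'v set set \<Rightarrow> 'v set set \<Rightarrow> (real ^ 'v set) set" where
  "LMC V E F = convex hull {char_vec (multicut (E \<union> F) \<P>) | \<P>. decomposition V E \<P>}"

text \<open>The inequality \<open>f x \<le> g x\<close> is valid for \<open>P\<close> and its equality set in \<open>P\<close> is a facet.\<close>

definition defines_facet ::
    "('a::euclidean_space \<Rightarrow> real) \<Rightarrow> ('a \<Rightarrow> real) \<Rightarrow> 'a set \<Rightarrow> bool" where
  "defines_facet f g P \<longleftrightarrow> (\<forall>x\<in>P. f x \<le> g x) \<and> {x \<in> P. f x = g x} facet_of P"

end

theory Submission
  imports Defs
begin

text \<open>
  Take a map \<open>\<phi>\<close> on the nodes with connected fibres and nodes \<open>a\<close>, \<open>b\<close> with distinct images, and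
  let \<open>Q\<close> be the node set of a path from \<open>\<phi> a\<close> to \<open>\<phi> b\<close> in the quotient of \<open>G\<close> by \<open>\<phi>\<close>.
  For each of \<open>T = Q, Q - {\<phi> a}, Q - {\<phi> b}, Q - {\<phi> a, \<phi> b}\<close>, merging the fibres over \<open>T\<close>
  gives a decomposition. By inclusion-exclusion, the alternating sum of the four characteristic
  vectors is, up to sign, the characteristic vector of the set of those edges that join the fibres
  of \<open>a\<close> and \<open>b\<close>.

  For \<open>\<phi> = id\<close> this shows that the lifted multicut polytope has full dimension. If \<open>\<phi>\<close> contracts an
  edge \<open>e \<in> E\<close> that lies in no triangle, every other edge is the only one between its two fibres,
  so the face \<open>x\<^sub>e = 0\<close> has codimension one. Conversely, by full dimension no facet \<open>x\<^sub>e = 0\<close>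
  satisfies a further linear equation, but each excluded configuration provides one:
  \<open>x\<^sub>f = 0\<close>, \<open>x\<^sub>f = x\<^sub>g\<close> or \<open>x\<^sub>f + x\<^sub>g = x\<^sub>h\<close>.
\<close>

subsection \<open>Connectedness\<close>

abbreviation adj_in :: "'v set set \<Rightarrow> 'v set \<Rightarrow> 'v \<Rightarrow> 'v \<Rightarrow> bool" where
  "adj_in E B \<equiv> (\<lambda>x y. x \<in> B \<and> y \<in> B \<and> {x, y} \<in> E)"

text \<open>Induction from the front. If the new node \<open>a\<close> already occurs in the list,
  the detour before that occurrence is cut off, which keeps the list distinct.\<close>

lemma rtranclp_imp_distinct_list:
  assumes "R\<^sup>*\<^sup>* a b"
  shows "\<exists>p. p \<noteq> [] \<and> distinct p \<and> hd p = a \<and> last p = b \<and> successively R p"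
  using assms
proof (induction rule: converse_rtranclp_induct)
  case base
  show ?case by (intro exI[of _ "[b]"]) simp
next
  case (step a c)
  then obtain p where p: "p \<noteq> []" "distinct p" "hd p = c" "last p = b" "successively R p"
    by blast
  show ?case
  proof (cases "a \<in> set p")
    case True
    then obtain xs ys where "p = xs @ a # ys" by (meson split_list)
    with p show ?thesis
      by (intro exI[of _ "a # ys"]) (auto simp: successively_append_iff)
  next
    case False
    with p step(1) show ?thesis
      by (intro exI[of _ "a # p"]) (auto simp: successively_Cons)
  qed
qed

lemma successively_imp_rtranclp:
  "p \<noteq> [] \<Longrightarrow> successively R p \<Longrightarrow> R\<^sup>*\<^sup>* (hd p) (last p)"
proof (induction p)
  case step: (Cons x p)
  show ?case
  proof (cases p)
    case (Cons y q)
    with step.prems have "R x y" "successively R p" by auto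
    with step.IH Cons show ?thesis
      by (metis converse_rtranclp_into_rtranclp last_ConsR list.sel(1) list.distinct(1))
  qed simp
qed simp

lemma successively_conj_Ball:
  "successively R p \<Longrightarrow> set p \<subseteq> B \<Longrightarrow> successively (\<lambda>x y. x \<in> B \<and> y \<in> B \<and> R x y) p"
  by (induction p rule: induct_list012) auto

lemma is_path_imp_rtranclp:
  assumes "is_path B E x y p"
  shows "(adj_in E B)\<^sup>*\<^sup>* x y"
  using assms successively_imp_rtranclp[of p "adj_in E B"]
    successively_conj_Ball[where R = "\<lambda>x y. {x, y} \<in> E" and B = B and p = p]
  unfolding is_path_def by auto

lemma rtranclp_imp_is_path:
  assumes "(adj_in E B)\<^sup>*\<^sup>* x y" "x \<in> B"
  shows "\<exists>p. is_path B E x y p"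
proof -
  obtain p where p: "p \<noteq> []" "distinct p" "hd p = x" "last p = y" "successively (adj_in E B) p"
    using rtranclp_imp_distinct_list[OF assms(1)] by blast
  have "set p \<subseteq> B"
    using p(1,3,5) assms(2)
  proof (induction p arbitrary: x)
    case (Cons z p)
    then show ?case by (cases p) auto
  qed simp
  moreover have "successively (\<lambda>a b. {a, b} \<in> E) p"
    using p(5) by (rule successively_mono) auto
  ultimately show ?thesis using p unfolding is_path_def by blast
qed

lemma is_path_induced_iff:
  "is_path B (induced_edges E B) x y p \<longleftrightarrow> is_path B E x y p"
proof -
  have "successively (\<lambda>a b. {a, b} \<in> induced_edges E B) p \<longleftrightarrow>
        successively (\<lambda>a b. {a, b} \<in> E) p" if "set p \<subseteq> B"
    using that by (induction p rule: induct_list012) (auto simp: induced_edges_def)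
  then show ?thesis unfolding is_path_def by blast
qed

text \<open>Reachability replaces distinct paths, so that connections can be concatenated
  freely.\<close>

lemma connected_induced_iff:
  "connected_graph B (induced_edges E B) \<longleftrightarrow>
     B \<noteq> {} \<and> (\<forall>x\<in>B. \<forall>y\<in>B. (adj_in E B)\<^sup>*\<^sup>* x y)"
  unfolding connected_graph_def is_path_induced_iff
  using rtranclp_imp_is_path[of B E] is_path_imp_rtranclp[of B E] by blast

lemma connected_induced_singleton: "connected_graph {x} (induced_edges E {x})"
  by (simp add: connected_induced_iff)

text \<open>Any two nodes on different sides are linked through the edge
  \<open>{a, b}\<close>.\<close>

lemma connected_induced_Un:
  assumes A: "connected_graph A (induced_edges E A)"
    and B: "connected_graph B (induced_edges E B)"
    and ab: "a \<in> A" "b \<in> B" "{a, b} \<in> E"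
  shows "connected_graph (A \<union> B) (induced_edges E (A \<union> B))"
proof -
  let ?R = "adj_in E (A \<union> B)"
  have mA: "?R\<^sup>*\<^sup>* x y" if "x \<in> A" "y \<in> A" for x y
    using A that rtranclp_mono[of "adj_in E A" ?R] unfolding connected_induced_iff by blast
  have mB: "?R\<^sup>*\<^sup>* x y" if "x \<in> B" "y \<in> B" for x y
    using B that rtranclp_mono[of "adj_in E B" ?R] unfolding connected_induced_iff by blast
  have R: "?R a b" "?R b a" using ab by (auto simp: insert_commute)
  have AB: "?R\<^sup>*\<^sup>* x y" if "x \<in> A" "y \<in> B" for x y
    using mA[OF that(1) ab(1)] R(1) mB[OF ab(2) that(2)]
    by (rule rtranclp_trans[OF rtranclp.rtrancl_into_rtrancl])
  have BA: "?R\<^sup>*\<^sup>* x y" if "x \<in> B" "y \<in> A" for x y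
    using mB[OF that(1) ab(2)] R(2) mA[OF ab(1) that(2)]
    by (rule rtranclp_trans[OF rtranclp.rtrancl_into_rtrancl])
  have "?R\<^sup>*\<^sup>* x y" if "x \<in> A \<union> B" "y \<in> A \<union> B" for x y
    using that mA[of x y] mB[of x y] AB[of x y] BA[of x y] by blast
  then show ?thesis using ab unfolding connected_induced_iff by blast
qed

subsection \<open>Partitions into fibres\<close>

text \<open>Decompositions are presented as kernels of maps, so that merging blocks means changing
  the map.\<close>

definition fibre_partition :: "'v set \<Rightarrow> ('v \<Rightarrow> 'b) \<Rightarrow> 'v set set" where
  "fibre_partition V h = (\<lambda>x. {y \<in> V. h y = h x}) ` V"

lemma partition_on_fibre_partition: "partition_on V (fibre_partition V h)"
  by (rule partition_onI) (auto simp: fibre_partition_def disjnt_def)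

lemma same_fibre_block_iff:
  "a \<in> V \<Longrightarrow> b \<in> V \<Longrightarrow> (\<exists>B\<in>fibre_partition V h. a \<in> B \<and> b \<in> B) \<longleftrightarrow> h a = h b"
  by (auto simp: fibre_partition_def)

text \<open>Blocks are disjoint, so each end node determines its block, and the choice of
  representatives in the definition of \<open>multicut\<close> is immaterial.\<close>

lemma edge_in_multicut_iff:
  assumes P: "partition_on V \<P>" and ab: "a \<in> V" "b \<in> V" "{a, b} \<in> H"
  shows "{a, b} \<in> multicut H \<P> \<longleftrightarrow> \<not> (\<exists>B\<in>\<P>. a \<in> B \<and> b \<in> B)"
proof -
  obtain A B where AB: "A \<in> \<P>" "a \<in> A" "B \<in> \<P>" "b \<in> B"
    using P ab partition_onD1 by blast
  have uniq: "X = Y" if "X \<in> \<P>" "Y \<in> \<P>" "x \<in> X" "x \<in> Y" for X Y x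
    using that P unfolding partition_on_def disjoint_def by blast
  show ?thesis
  proof
    assume "{a, b} \<in> multicut H \<P>"
    then obtain a' b' A' B' where *: "{a, b} = {a', b'}" "A' \<in> \<P>" "B' \<in> \<P>" "A' \<noteq> B'"
      "a' \<in> A'" "b' \<in> B'"
      unfolding multicut_def by blast
    show "\<not> (\<exists>B\<in>\<P>. a \<in> B \<and> b \<in> B)"
    proof
      assume "\<exists>B\<in>\<P>. a \<in> B \<and> b \<in> B"
      then obtain C where "C \<in> \<P>" "a \<in> C" "b \<in> C" by blast
      then have "a' \<in> C" "b' \<in> C" using *(1) by (auto simp: doubleton_eq_iff)
      then show False using * uniq[of A' C a'] uniq[of B' C b'] \<open>C \<in> \<P>\<close> by simp
    qed
  next
    assume "\<not> (\<exists>B\<in>\<P>. a \<in> B \<and> b \<in> B)"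
    then have "A \<noteq> B" using AB by blast
    then show "{a, b} \<in> multicut H \<P>" using AB ab(3) unfolding multicut_def by blast
  qed
qed

lemma decomposition_fibre_partition:
  assumes "\<And>x. x \<in> V \<Longrightarrow>
    connected_graph {y \<in> V. h y = h x} (induced_edges E {y \<in> V. h y = h x})"
  shows "decomposition V E (fibre_partition V h)"
  using assms partition_on_fibre_partition[of V h]
  unfolding decomposition_def by (auto simp: fibre_partition_def)

text \<open>Induction along \<open>q\<close>: each step of \<open>q\<close> comes from an edge of
  the graph, which attaches the next connected fibre to the union of the later ones.\<close>

lemma connected_fibres_over_path:
  assumes fib: "\<And>x. x \<in> V \<Longrightarrow>
      connected_graph {y \<in> V. \<phi> y = \<phi> x} (induced_edges E {y \<in> V. \<phi> y = \<phi> x})"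
    and q: "q \<noteq> []" "set q \<subseteq> \<phi> ` V"
      "successively (\<lambda>s t. \<exists>x\<in>V. \<exists>y\<in>V. {x, y} \<in> E \<and> \<phi> x = s \<and> \<phi> y = t) q"
  shows "connected_graph {y \<in> V. \<phi> y \<in> set q} (induced_edges E {y \<in> V. \<phi> y \<in> set q})"
  using q
proof (induction q rule: induct_list012)
  case (2 s)
  then show ?case using fib by auto
next
  case (3 s t r)
  let ?P = "{y \<in> V. \<phi> y \<in> set (t # r)}"
  obtain x y where xy: "x \<in> V" "y \<in> V" "{x, y} \<in> E" "\<phi> x = s" "\<phi> y = t"
    using 3(5) by auto
  have "connected_graph ({y \<in> V. \<phi> y = \<phi> x} \<union> ?P) (induced_edges E ({y \<in> V. \<phi> y = \<phi> x} \<union> ?P))"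
    using 3 xy by (intro connected_induced_Un[OF fib, of x _ x y]) auto
  moreover have "{y \<in> V. \<phi> y = \<phi> x} \<union> ?P = {y \<in> V. \<phi> y \<in> set (s # t # r)}"
    using xy(4) by auto
  ultimately show ?case by simp
qed simp

subsection \<open>Unit vectors in the span of lifted multicuts\<close>

text \<open>\<open>None\<close> is the merged node of the quotient; the option type keeps it apart
  from all other values of \<open>\<phi>\<close>.\<close>

definition merge_map :: "('v \<Rightarrow> 'b) \<Rightarrow> 'b set \<Rightarrow> 'v \<Rightarrow> 'b option" where
  "merge_map \<phi> T x = (if \<phi> x \<in> T then None else Some (\<phi> x))"

lemma merge_map_eq_iff:
  "merge_map \<phi> T x = merge_map \<phi> T y \<longleftrightarrow> \<phi> x = \<phi> y \<or> \<phi> x \<in> T \<and> \<phi> y \<in> T"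
  by (auto simp: merge_map_def)

text \<open>The only new block is the union of the fibres over \<open>q\<close>. The list may be
  empty; then the blocks are the fibres themselves.\<close>

lemma decomposition_merge_path:
  assumes fib: "\<And>x. x \<in> V \<Longrightarrow>
      connected_graph {y \<in> V. \<phi> y = \<phi> x} (induced_edges E {y \<in> V. \<phi> y = \<phi> x})"
    and q: "set q \<subseteq> \<phi> ` V"
      "successively (\<lambda>s t. \<exists>x\<in>V. \<exists>y\<in>V. {x, y} \<in> E \<and> \<phi> x = s \<and> \<phi> y = t) q"
  shows "decomposition V E (fibre_partition V (merge_map \<phi> (set q)))"
proof (rule decomposition_fibre_partition)
  fix x assume x: "x \<in> V"
  let ?A = "{y \<in> V. merge_map \<phi> (set q) y = merge_map \<phi> (set q) x}"
  show "connected_graph ?A (induced_edges E ?A)"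
  proof (cases "\<phi> x \<in> set q")
    case True
    then have "?A = {y \<in> V. \<phi> y \<in> set q}" by (auto simp: merge_map_eq_iff)
    moreover have "q \<noteq> []" using True by auto
    ultimately show ?thesis using connected_fibres_over_path[OF fib, of q] q by simp
  next
    case False
    then have "?A = {y \<in> V. \<phi> y = \<phi> x}" by (auto simp: merge_map_eq_iff)
    then show ?thesis using fib[OF x] by simp
  qed
qed

text \<open>By \<open>uniq\<close>, the edges between the two fibres reduce to
  \<open>{a, b}\<close>, so inclusion-exclusion yields a unit vector. The generators keep every
  fibre of \<open>\<phi>\<close> uncut; this places them in the face of \<open>e\<close> when
  \<open>\<phi>\<close> contracts \<open>e\<close>.\<close>

lemma axis_in_span_multicuts:
  fixes V :: "'v::finite set" and \<phi> :: "'v \<Rightarrow> 'b"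
  assumes con: "connected_graph V E" and H: "H \<subseteq> nsets V 2"
    and fib: "\<And>x. x \<in> V \<Longrightarrow>
      connected_graph {y \<in> V. \<phi> y = \<phi> x} (induced_edges E {y \<in> V. \<phi> y = \<phi> x})"
    and f: "{a, b} \<in> H" "\<phi> a \<noteq> \<phi> b"
    and uniq: "\<And>c d. {c, d} \<in> H \<Longrightarrow> \<phi> c = \<phi> a \<Longrightarrow> \<phi> d = \<phi> b \<Longrightarrow> {c, d} = {a, b}"
  shows "axis {a, b} 1 \<in> span {char_vec (multicut H \<P>) | \<P>. decomposition V E \<P> \<and>
           (\<forall>x\<in>V. \<forall>y\<in>V. \<phi> x = \<phi> y \<longrightarrow> (\<exists>B\<in>\<P>. x \<in> B \<and> y \<in> B))}"
    (is "_ \<in> span ?G")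
proof -
  let ?R = "\<lambda>s t. \<exists>x\<in>V. \<exists>y\<in>V. {x, y} \<in> E \<and> \<phi> x = s \<and> \<phi> y = t"
  have ab: "a \<in> V" "b \<in> V" using subsetD[OF H f(1)] by simp_all
  obtain p where "is_path V E a b p"
    using con ab unfolding connected_graph_def by blast
  then have "(adj_in E V)\<^sup>*\<^sup>* a b" by (rule is_path_imp_rtranclp)
  \<comment> \<open>The path is projected to the quotient. Steps inside a fibre become loops, which
    disappear when a distinct list is extracted.\<close>
  then have "?R\<^sup>*\<^sup>* (\<phi> a) (\<phi> b)"
  proof (induction rule: rtranclp_induct)
    case (step y z)
    then have "?R (\<phi> y) (\<phi> z)" by blast
    with step.IH show ?case by (rule rtranclp.rtrancl_into_rtrancl)
  qed simp
  from rtranclp_imp_distinct_list[OF this] obtain q where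
    q: "q \<noteq> []" "distinct q" "hd q = \<phi> a" "last q = \<phi> b" "successively ?R q"
    by (elim exE conjE)
  \<comment> \<open>\<open>m\<close> is the interior of the quotient path, empty if the two fibres
    are adjacent there.\<close>
  obtain m where m: "q = \<phi> a # m @ [\<phi> b]"
  proof -
    obtain r where r: "q = \<phi> a # r" using q(1,3) by (cases q) auto
    then have "r \<noteq> []" "last r = \<phi> b" using q(4) f(2) by (auto split: if_splits)
    then have "q = \<phi> a # butlast r @ [\<phi> b]" using r by (metis append_butlast_last_id)
    then show thesis by (rule that)
  qed
  have sub: "set q \<subseteq> \<phi> ` V"
  proof -
    \<comment> \<open>Membership in the image is read off a step of \<open>?R\<close>, and a list
      with one entry has no step.\<close>
    have "t \<in> \<phi> ` V" if "successively ?R l" "t \<in> set l" "length l \<ge> 2" for l t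
      using that
    proof (induction l rule: induct_list012)
      case (3 x y zs)
      then show ?case by (cases zs) auto
    qed auto
    from this[OF q(5)] show ?thesis by (auto simp: m)
  qed
  define X where "X T = char_vec (multicut H (fibre_partition V (merge_map \<phi> T)))" for T
  have X: "X (set l) \<in> span ?G" if "set l \<subseteq> set q" "successively ?R l" for l
  proof (rule span_base, unfold X_def, intro CollectI exI conjI refl ballI impI)
    show "decomposition V E (fibre_partition V (merge_map \<phi> (set l)))"
      using that sub by (intro decomposition_merge_path fib) auto
  qed (simp_all add: same_fibre_block_iff merge_map_eq_iff)
  have X_nth: "X T $ {c, d} = (if \<phi> c = \<phi> d \<or> \<phi> c \<in> T \<and> \<phi> d \<in> T then 0 else 1)"
    if cd: "{c, d} \<in> H" for T c d
  proof -
    have "c \<in> V" "d \<in> V" using subsetD[OF H cd] by simp_all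
    with cd have "{c, d} \<in> multicut H (fibre_partition V (merge_map \<phi> T)) \<longleftrightarrow>
        \<not> (\<phi> c = \<phi> d \<or> \<phi> c \<in> T \<and> \<phi> d \<in> T)"
      by (simp only: edge_in_multicut_iff[OF partition_on_fibre_partition]
          same_fibre_block_iff merge_map_eq_iff)
    then show ?thesis by (simp add: X_def char_vec_def indicator_def)
  qed
  have X_nth0: "X T $ g = 0" if "g \<notin> H" for T g
    using that by (simp add: X_def char_vec_def multicut_def)
  have s: "successively ?R (m @ [\<phi> b])" "successively ?R (\<phi> a # m)" "successively ?R m"
    using q(5) successively_append_iff[of ?R "[\<phi> a]" "m @ [\<phi> b]"]
      successively_append_iff[of ?R "\<phi> a # m" "[\<phi> b]"] successively_append_iff[of ?R m "[\<phi> b]"]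
    unfolding m by simp_all
  \<comment> \<open>On an edge between distinct fibres, \<open>X T\<close> is 1 minus the indicator
    that both end fibres lie in \<open>T\<close>. The ones cancel, and the indicators leave 1
    exactly when the end fibres are those of \<open>a\<close> and \<open>b\<close>.\<close>
  let ?Y = "X (set (m @ [\<phi> b])) + X (set (\<phi> a # m)) - X (set q) - X (set m)"
  have "?Y \<in> span ?G"
    using s q(5) by (intro span_add span_diff X) (auto simp: m)
  moreover have "?Y = axis {a, b} 1"
  proof (subst vec_eq_iff, intro allI)
    fix g
    show "?Y $ g = axis {a, b} 1 $ g"
    proof (cases "g \<in> H")
      case False
      then show ?thesis using f by (auto simp: X_nth0 axis_def)
    next
      case True
      then obtain c d where g: "g = {c, d}" using H nsets2_E by (metis subsetD)
      have dist: "\<phi> a \<notin> set m" "\<phi> b \<notin> set m" using q(2) m by auto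
      show ?thesis
      proof (cases "(\<phi> c = \<phi> a \<and> \<phi> d = \<phi> b) \<or> (\<phi> c = \<phi> b \<and> \<phi> d = \<phi> a)")
        case c: True
        then have "g = {a, b}"
          using uniq[of c d] uniq[of d c] True g by (auto simp: insert_commute)
        then show ?thesis using f dist by (simp add: X_nth m)
      next
        case c: False
        then have "g \<noteq> {a, b}" using g by (auto simp: doubleton_eq_iff)
        then show ?thesis using c True f dist unfolding g
          by (auto simp: X_nth m axis_def)
      qed
    qed
  qed
  ultimately show ?thesis by simp
qed

subsection \<open>Facets of the lifted multicut polytope\<close>

abbreviation multicut_vecs :: "'v::finite set \<Rightarrow> 'v set set \<Rightarrow> 'v set set \<Rightarrow> (real ^ 'v set) set"
  where "multicut_vecs V E H \<equiv> {char_vec (multicut H \<P>) | \<P>. decomposition V E \<P>}"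

lemma LMC_eq: "LMC V E F = convex hull (multicut_vecs V E (E \<union> F))"
  by (simp add: LMC_def)

lemma finite_multicut_vecs: "finite (multicut_vecs V E H)"
proof -
  have "multicut_vecs V E H \<subseteq> range char_vec" by auto
  then show ?thesis using finite_subset by fastforce
qed

text \<open>The decomposition into the single block \<open>V\<close> cuts nothing. With the origin
  in the polytope, affine dimensions become linear ones.\<close>

lemma zero_in_multicut_vecs:
  assumes "connected_graph V E" "H \<subseteq> nsets V 2"
  shows "0 \<in> multicut_vecs V E H"
proof -
  let ?P = "fibre_partition V (\<lambda>x. ())"
  have "is_path V (induced_edges E V) = is_path V E"
    by (intro ext) (rule is_path_induced_iff)
  with assms(1) have "decomposition V E ?P"
    by (intro decomposition_fibre_partition) (simp add: connected_graph_def)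
  moreover have "multicut H ?P = {}"
  proof (rule equals0I)
    fix g assume g: "g \<in> multicut H ?P"
    then have "g \<in> H" by (simp add: multicut_def)
    then obtain a b where "g = {a, b}" "a \<in> V" "b \<in> V"
      using assms(2) by (meson nsets2_E subsetD)
    with g \<open>g \<in> H\<close> show False
      using edge_in_multicut_iff[OF partition_on_fibre_partition[of V "\<lambda>x. ()"], of a b H]
        same_fibre_block_iff[of a V b "\<lambda>x. ()"] by simp
  qed
  moreover have "char_vec {} = 0" by (simp add: char_vec_def vec_eq_iff)
  ultimately show ?thesis by (metis (mono_tags, lifting) mem_Collect_eq)
qed

section \<open>Coordinate subspaces and full dimension\<close>

abbreviation coordinate_space :: "'i set \<Rightarrow> (real ^ 'i::finite) set" where
  "coordinate_space I \<equiv> span ((\<lambda>i. axis i 1) ` I)"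

lemma dim_axis_image: "dim ((\<lambda>i. axis i (1::real)) ` I) = card I"
proof -
  have inj: "inj (\<lambda>i :: 'a. axis i (1::real))" by (auto simp: inj_def axis_eq_axis)
  have "independent ((\<lambda>i :: 'a. axis i (1::real)) ` I)"
    by (rule independent_mono[OF independent_Basis]) (auto simp: Basis_vec_def)
  then show ?thesis
    using inj by (simp add: dim_eq_card_independent card_image inj_on_subset)
qed

lemma in_coordinate_space:
  fixes x :: "real ^ 'i::finite"
  assumes "\<And>i. i \<notin> I \<Longrightarrow> x $ i = 0"
  shows "x \<in> coordinate_space I"
proof -
  have "x = (\<Sum>i\<in>UNIV. x $ i *\<^sub>R axis i 1)"
    using basis_expansion[of x] by (simp add: scalar_mult_eq_scaleR)
  moreover have "(\<Sum>i\<in>UNIV. x $ i *\<^sub>R axis i 1) \<in> coordinate_space I"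
  proof (rule span_sum)
    fix i
    show "x $ i *\<^sub>R axis i 1 \<in> coordinate_space I"
    proof (cases "i \<in> I")
      case True
      then show ?thesis by (intro span_scale span_base imageI)
    next
      case False
      then show ?thesis using assms by (simp add: span_zero)
    qed
  qed
  ultimately show ?thesis by simp
qed

lemma LMC_nth_eq_0:
  assumes "x \<in> LMC V E F" "i \<notin> E \<union> F"
  shows "x $ i = 0"
proof -
  have "convex {x :: real ^ 'a set. x $ i = 0}"
    by (auto simp: convex_def)
  then have "LMC V E F \<subseteq> {x. x $ i = 0}"
    unfolding LMC_eq using assms(2)
    by (intro hull_minimal) (auto simp: char_vec_def multicut_def)
  then show ?thesis using assms(1) by blast
qed

lemma LMC_nth_ge_0:
  assumes "x \<in> LMC V E F"
  shows "0 \<le> x $ i"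
proof -
  have "convex {x :: real ^ 'a set. 0 \<le> x $ i}"
    by (auto simp: convex_def)
  then have "LMC V E F \<subseteq> {x. 0 \<le> x $ i}"
    unfolding LMC_eq
    by (intro hull_minimal) (auto simp: char_vec_def)
  then show ?thesis using assms(1) by blast
qed

text \<open>Coordinates outside \<open>E \<union> F\<close> vanish, which bounds the dimension from
  above; the unit vectors obtained with \<open>\<phi> = id\<close> bound it from below.\<close>

lemma aff_dim_LMC:
  assumes con: "connected_graph V E" and H: "E \<union> F \<subseteq> nsets V 2"
  shows "aff_dim (LMC V E F) = int (card (E \<union> F))"
proof -
  have "span (multicut_vecs V E (E \<union> F)) \<subseteq> span (LMC V E F)"
    unfolding LMC_eq by (intro span_mono hull_subset)
  moreover have "axis f 1 \<in> span (multicut_vecs V E (E \<union> F))" if f: "f \<in> E \<union> F" for f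
  proof -
    obtain a b where ab: "f = {a, b}" "a \<noteq> b" using f H by (meson nsets2_E subsetD)
    have "axis {a, b} 1 \<in> span {char_vec (multicut (E \<union> F) \<P>) | \<P>. decomposition V E \<P> \<and>
           (\<forall>x\<in>V. \<forall>y\<in>V. id x = id y \<longrightarrow> (\<exists>B\<in>\<P>. x \<in> B \<and> y \<in> B))}"
    proof (rule axis_in_span_multicuts[OF con H])
      fix x assume "x \<in> V"
      then have "{y \<in> V. id y = id x} = {x}" by auto
      then show "connected_graph {y \<in> V. id y = id x} (induced_edges E {y \<in> V. id y = id x})"
        using connected_induced_singleton by metis
    qed (use f ab in auto)
    also have "\<dots> \<subseteq> span (multicut_vecs V E (E \<union> F))" by (rule span_mono) auto
    finally show ?thesis using ab by simp
  qed
  ultimately have "(\<lambda>f. axis f 1) ` (E \<union> F) \<subseteq> span (LMC V E F)"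
    by blast
  then have "coordinate_space (E \<union> F) \<subseteq> span (LMC V E F)"
    by (rule span_minimal) (rule subspace_span)
  moreover have "LMC V E F \<subseteq> coordinate_space (E \<union> F)"
    by (intro subsetI in_coordinate_space) (rule LMC_nth_eq_0)
  ultimately have "span (LMC V E F) = coordinate_space (E \<union> F)"
    by (metis span_minimal subset_antisym subspace_span)
  then have "dim (LMC V E F) = card (E \<union> F)"
    using dim_axis_image[of "E \<union> F"] by (metis dim_span)
  moreover have "0 \<in> LMC V E F"
    using zero_in_multicut_vecs[OF con H] unfolding LMC_eq by (rule hull_inc)
  ultimately show ?thesis using aff_dim_zero[OF hull_inc[of 0 "LMC V E F"]] by simp
qed

section \<open>Linear criteria for a facet\<close>

lemma nonneg_face_LMC: "{x \<in> LMC V E F. 0 = x $ e} face_of LMC V E F"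
proof -
  have "{x \<in> LMC V E F. 0 = x $ e} = LMC V E F \<inter> {x. axis e 1 \<bullet> x = 0}"
    by (auto simp: inner_axis')
  moreover have "LMC V E F \<inter> {x. axis e 1 \<bullet> x = 0} face_of LMC V E F"
    using LMC_nth_ge_0
    by (intro face_of_Int_supporting_hyperplane_ge) (auto simp: inner_axis' LMC_eq)
  ultimately show ?thesis by simp
qed

text \<open>The face contains the origin and lies in the coordinate space of the remaining edges.
  Its codimension is one exactly when it spans that space, that is, when its span contains each of
  the unit vectors.\<close>

lemma facet_nonneg_LMC_iff:
  assumes con: "connected_graph V E" and H: "E \<union> F \<subseteq> nsets V 2" and e: "e \<in> E \<union> F"
  shows "defines_facet (\<lambda>x. 0) (\<lambda>x. x $ e) (LMC V E F) \<longleftrightarrow>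
           (\<forall>f\<in>E \<union> F - {e}. axis f 1 \<in> span {x \<in> LMC V E F. 0 = x $ e})"
proof -
  let ?S = "{x \<in> LMC V E F. 0 = x $ e}" and ?I = "E \<union> F - {e}"
  have 0: "0 \<in> ?S"
    using zero_in_multicut_vecs[OF con H] unfolding LMC_eq by (simp add: hull_inc)
  have card: "int (card ?I) = int (card (E \<union> F)) - 1"
    using e by (metis card_Suc_Diff1 finite_code add_diff_cancel_left' of_nat_Suc)
  have "?S \<noteq> {}" using 0 by blast
  moreover have "\<forall>x\<in>LMC V E F. 0 \<le> x $ e" using LMC_nth_ge_0 by blast
  ultimately have "defines_facet (\<lambda>x. 0) (\<lambda>x. x $ e) (LMC V E F) \<longleftrightarrow>
      aff_dim ?S = aff_dim (LMC V E F) - 1"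
    unfolding defines_facet_def facet_of_def using nonneg_face_LMC[of V E F e] by argo
  then have "defines_facet (\<lambda>x. 0) (\<lambda>x. x $ e) (LMC V E F) \<longleftrightarrow> dim ?S = card ?I"
    using aff_dim_zero[OF hull_inc[OF 0]] card aff_dim_LMC[OF con H] by linarith
  moreover have sub: "span ?S \<subseteq> coordinate_space ?I"
  proof (rule span_minimal[OF subsetI subspace_span], rule in_coordinate_space)
    fix x i assume x: "x \<in> ?S" and i: "i \<notin> ?I"
    show "x $ i = 0"
    proof (cases "i = e")
      case False
      with i have "i \<notin> E \<union> F" by blast
      with x show ?thesis using LMC_nth_eq_0 by blast
    qed (use x in simp)
  qed
  have "dim ?S = card ?I \<longleftrightarrow> coordinate_space ?I \<subseteq> span ?S"
  proof
    assume d: "dim ?S = card ?I"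
    have "span ?S = coordinate_space ?I"
      by (rule subspace_dim_equal[OF subspace_span subspace_span sub])
        (simp only: dim_span dim_axis_image d order_refl)
    then show "coordinate_space ?I \<subseteq> span ?S" by (rule equalityD2)
  next
    assume "coordinate_space ?I \<subseteq> span ?S"
    with sub have "span ?S = coordinate_space ?I" by (rule subset_antisym)
    then have "dim (span ?S) = dim (coordinate_space ?I)" by (rule arg_cong)
    then show "dim ?S = card ?I" unfolding dim_span dim_axis_image .
  qed
  moreover have "coordinate_space ?I \<subseteq> span ?S \<longleftrightarrow> (\<forall>f\<in>?I. axis f 1 \<in> span ?S)"
  proof
    assume "coordinate_space ?I \<subseteq> span ?S"
    then show "\<forall>f\<in>?I. axis f 1 \<in> span ?S" by (intro ballI) (erule subsetD, intro span_base imageI)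
  next
    assume "\<forall>f\<in>?I. axis f 1 \<in> span ?S"
    then show "coordinate_space ?I \<subseteq> span ?S"
      by (intro span_minimal[OF image_subsetI subspace_span]) blast
  qed
  ultimately show ?thesis by blast
qed

text \<open>A linear equation valid on the face also holds on its span, which contains
  \<open>axis f 1\<close> for a facet.\<close>

lemma facet_equation_trivial:
  fixes c :: "real ^ 'v::finite set"
  assumes con: "connected_graph V E" and H: "E \<union> F \<subseteq> nsets V 2" and e: "e \<in> E \<union> F"
    and facet: "defines_facet (\<lambda>x. 0) (\<lambda>x. x $ e) (LMC V E F)"
    and eq: "\<And>\<P>. decomposition V E \<P> \<Longrightarrow> e \<notin> multicut (E \<union> F) \<P> \<Longrightarrow>
               c \<bullet> char_vec (multicut (E \<union> F) \<P>) = 0"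
    and f: "f \<in> E \<union> F" "f \<noteq> e"
  shows "c $ f = 0"
proof -
  let ?S = "{x \<in> LMC V E F. 0 = x $ e}"
  have "?S face_of convex hull (multicut_vecs V E (E \<union> F))"
    using nonneg_face_LMC[of V E F e] by (simp only: LMC_eq)
  \<comment> \<open>A face of the hull is the hull of some of the generators, so the equation needs
    checking only on multicuts that leave \<open>e\<close> uncut.\<close>
  from face_of_convex_hull_subset[OF finite_imp_compact[OF finite_multicut_vecs] this]
  obtain S' where S': "S' \<subseteq> multicut_vecs V E (E \<union> F)" "?S = convex hull S'" .
  have "c \<bullet> x = 0" if x: "x \<in> S'" for x
  proof -
    obtain \<P> where P: "decomposition V E \<P>" "x = char_vec (multicut (E \<union> F) \<P>)"
      using x S'(1) by blast
    have "x \<in> ?S" unfolding S'(2) using x by (rule hull_inc)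
    then have "e \<notin> multicut (E \<union> F) \<P>" using P(2) by (auto simp: char_vec_def)
    then show ?thesis using eq P by blast
  qed
  then have "?S \<subseteq> {x. c \<bullet> x = 0}"
    unfolding S'(2) by (intro hull_minimal convex_hyperplane) auto
  then have "span ?S \<subseteq> {x. c \<bullet> x = 0}"
    by (intro span_minimal subspace_hyperplane)
  moreover have "axis f 1 \<in> span ?S"
    using facet f unfolding facet_nonneg_LMC_iff[OF con H e] by blast
  ultimately show ?thesis by (auto simp: inner_axis)
qed

subsection \<open>Contracting an edge in no triangle\<close>

text \<open>\<open>\<phi>\<close> identifies \<open>v\<close> with \<open>u\<close>. Two distinct
  edges between the same two fibres would share one end node and have \<open>u\<close> and
  \<open>v\<close> as the others, forming a triangle with \<open>e\<close>.\<close>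

lemma facet_if_no_triangle:
  assumes con: "connected_graph V E" and H: "E \<union> F \<subseteq> nsets V 2" and e: "e \<in> E"
    and tri: "\<not> in_triangle (E \<union> F) e"
  shows "defines_facet (\<lambda>x. 0) (\<lambda>x. x $ e) (LMC V E F)"
proof -
  have eH: "e \<in> E \<union> F" using e by blast
  obtain u v where uv: "e = {u, v}" "u \<in> V" "v \<in> V" "u \<noteq> v" using eH H by (meson nsets2_E subsetD)
  define \<phi> where "\<phi> = id(v := u)"
  have \<phi>_eq_iff: "\<phi> x = \<phi> y \<longleftrightarrow> x = y \<or> {x, y} = {u, v}" for x y
    by (auto simp: \<phi>_def doubleton_eq_iff)
  have no_tri: False
    if "{x, y} = {u, v}" "{x, w} \<in> E \<union> F" "{y, w} \<in> E \<union> F" "w \<noteq> x" "w \<noteq> y" for x y w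
  proof -
    have "x \<noteq> y" using that(1) uv(4) by (auto simp: doubleton_eq_iff)
    then have "is_triangle (E \<union> F) x y w"
      using that eH uv(1) unfolding is_triangle_def by simp
    moreover have "e = {x, y}" using that(1) uv(1) by simp
    ultimately show False using tri unfolding in_triangle_def by blast
  qed
  let ?G = "{char_vec (multicut (E \<union> F) \<P>) | \<P>. decomposition V E \<P> \<and>
         (\<forall>x\<in>V. \<forall>y\<in>V. \<phi> x = \<phi> y \<longrightarrow> (\<exists>B\<in>\<P>. x \<in> B \<and> y \<in> B))}"
  have "?G \<subseteq> {x \<in> LMC V E F. 0 = x $ e}"
  proof
    fix x assume "x \<in> ?G"
    then obtain \<P> where P: "x = char_vec (multicut (E \<union> F) \<P>)" "decomposition V E \<P>"
        "\<forall>x\<in>V. \<forall>y\<in>V. \<phi> x = \<phi> y \<longrightarrow> (\<exists>B\<in>\<P>. x \<in> B \<and> y \<in> B)"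
      by blast
    have "\<phi> u = \<phi> v" by (simp add: \<phi>_def)
    then have "\<exists>B\<in>\<P>. u \<in> B \<and> v \<in> B" using P(3) uv(2,3) by blast
    then have "e \<notin> multicut (E \<union> F) \<P>"
      using edge_in_multicut_iff[of V \<P> u v] uv eH P(2) unfolding decomposition_def by blast
    moreover have "x \<in> LMC V E F" unfolding LMC_eq using P by (blast intro: hull_inc)
    ultimately show "x \<in> {x \<in> LMC V E F. 0 = x $ e}" using P(1) by (simp add: char_vec_def)
  qed
  then have sub: "span ?G \<subseteq> span {x \<in> LMC V E F. 0 = x $ e}" by (rule span_mono)
  have "axis f 1 \<in> span ?G" if f: "f \<in> E \<union> F - {e}" for f
  proof -
    obtain a b where ab: "f = {a, b}" "a \<noteq> b" using f H by (meson DiffD1 nsets2_E subsetD)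
    have "axis {a, b} 1 \<in> span ?G"
    proof (rule axis_in_span_multicuts[OF con H])
      fix x assume x: "x \<in> V"
      show "connected_graph {y \<in> V. \<phi> y = \<phi> x} (induced_edges E {y \<in> V. \<phi> y = \<phi> x})"
      proof (cases "x \<in> {u, v}")
        case True
        then have "{y \<in> V. \<phi> y = \<phi> x} = {u} \<union> {v}"
          using uv by (auto simp: \<phi>_def)
        moreover have "connected_graph ({u} \<union> {v}) (induced_edges E ({u} \<union> {v}))"
          using e uv(1)
          by (intro connected_induced_Un[of _ _ _ u v] connected_induced_singleton) auto
        ultimately show ?thesis by simp
      next
        case False
        then have "{y \<in> V. \<phi> y = \<phi> x} = {x}" using x by (auto simp: \<phi>_def)
        then show ?thesis using connected_induced_singleton by metis
      qed
    next
      show "\<phi> a \<noteq> \<phi> b" using f ab uv(1) by (auto simp: \<phi>_eq_iff)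
    next
      fix c d assume cd: "{c, d} \<in> E \<union> F" "\<phi> c = \<phi> a" "\<phi> d = \<phi> b"
      have abH: "{a, b} \<in> E \<union> F" "{a, b} \<noteq> {u, v}" using f ab uv by auto
      show "{c, d} = {a, b}"
      proof (cases "c = a")
        case c: True
        show ?thesis
        proof (cases "d = b")
          case False
          then have db: "{d, b} = {u, v}" using cd(3) \<phi>_eq_iff by blast
          then have "a \<noteq> d" using abH(2) by auto
          then have False
            using no_tri[OF db, of a] cd(1) abH(1) c ab(2) by (simp add: insert_commute)
          then show ?thesis ..
        qed (simp add: c)
      next
        case False
        then have ca: "{c, a} = {u, v}" using cd(2) \<phi>_eq_iff by blast
        then have "b \<noteq> c" using abH(2) by (auto simp: insert_commute)
        \<comment> \<open>Since \<open>c\<close> and \<open>a\<close> are the two ends of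
          \<open>e\<close>, the node \<open>b\<close> lies off \<open>e\<close> and is alone in its
          fibre; this forces \<open>d = b\<close>.\<close>
        then have "b \<noteq> u" "b \<noteq> v" using ca ab(2) by (auto simp: doubleton_eq_iff)
        then have "d = b" using cd(3) \<phi>_eq_iff[of d b] by (auto simp: doubleton_eq_iff)
        then have False
          using no_tri[OF ca, of b] cd(1) abH(1) \<open>b \<noteq> c\<close> ab(2) by simp
        then show ?thesis ..
      qed
    qed (use f ab in auto)
    then show ?thesis using ab by simp
  qed
  then show ?thesis
    unfolding facet_nonneg_LMC_iff[OF con H eH] using sub by blast
qed

subsection \<open>Equations on the face of an uncut edge\<close>

lemma char_vec_multicut_nth:
  assumes "decomposition V E \<P>" "H \<subseteq> nsets V 2" "{a, b} \<in> H"
  shows "char_vec (multicut H \<P>) $ {a, b} = (if \<exists>B\<in>\<P>. a \<in> B \<and> b \<in> B then 0 else 1)"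
proof -
  have "a \<in> V" "b \<in> V" using subsetD[OF assms(2,3)] by simp_all
  then show ?thesis
    using assms edge_in_multicut_iff[of V \<P> a b H]
    by (auto simp: char_vec_def decomposition_def)
qed

lemma same_block_trans:
  assumes "decomposition V E \<P>"
    and "\<exists>B\<in>\<P>. a \<in> B \<and> b \<in> B" "\<exists>B\<in>\<P>. b \<in> B \<and> c \<in> B"
  shows "\<exists>B\<in>\<P>. a \<in> B \<and> c \<in> B"
  using assms unfolding decomposition_def partition_on_def disjoint_def by blast

text \<open>A path from \<open>u\<close> to \<open>v\<close> inside the connected block is also a
  path in the whole graph.\<close>

lemma separating_meets_block:
  assumes P: "decomposition V E \<P>" and sep: "separating V E u v S"
    and B: "B \<in> \<P>" "u \<in> B" "v \<in> B"
  shows "S \<inter> B \<noteq> {}"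
proof -
  have "B \<subseteq> V" "connected_graph B (induced_edges E B)"
    using P B(1) partition_onD1 unfolding decomposition_def by blast+
  then obtain p where p: "is_path B E u v p"
    using B unfolding connected_graph_def is_path_induced_iff by blast
  then have "is_path V E u v p" "set p \<subseteq> B" using \<open>B \<subseteq> V\<close> unfolding is_path_def by auto
  then show ?thesis using sep unfolding separating_def by blast
qed

section \<open>Necessary conditions for a facet\<close>

context
  fixes V :: "'v::finite set" and E F :: "'v set set" and e :: "'v set"
  assumes con: "connected_graph V E" and H: "E \<union> F \<subseteq> nsets V 2" and e: "e \<in> E \<union> F"
    and facet: "defines_facet (\<lambda>x. 0) (\<lambda>x. x $ e) (LMC V E F)"
begin

text \<open>Otherwise the coordinate of \<open>{a, b}\<close> would vanish on the whole
  face.\<close>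

lemma facet_cuts_other_edge:
  assumes "{a, b} \<in> E \<union> F" "{a, b} \<noteq> e"
  shows "\<exists>\<P>. decomposition V E \<P> \<and> e \<notin> multicut (E \<union> F) \<P> \<and> \<not> (\<exists>B\<in>\<P>. a \<in> B \<and> b \<in> B)"
proof (rule ccontr)
  assume *: "\<not> ?thesis"
  have "(axis {a, b} 1 :: real ^ 'v set) $ {a, b} = 0"
  proof (rule facet_equation_trivial[OF con H e facet])
    fix \<P> assume P: "decomposition V E \<P>" "e \<notin> multicut (E \<union> F) \<P>"
    with * have "\<exists>B\<in>\<P>. a \<in> B \<and> b \<in> B" by blast
    then show "axis {a, b} 1 \<bullet> char_vec (multicut (E \<union> F) \<P>) = 0"
      by (simp add: inner_axis' char_vec_multicut_nth[OF P(1) H assms(1)])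
  qed (use assms in auto)
  then show False by simp
qed

text \<open>Otherwise the two coordinates would agree on the face. Only \<open>{a, b}\<close> has to
  differ from \<open>e\<close>, since the contradiction arises at its coefficient.\<close>

lemma facet_distinguishes_edges:
  assumes ab: "{a, b} \<in> E \<union> F" "{a, b} \<noteq> e" and cd: "{c, d} \<in> E \<union> F" "{c, d} \<noteq> {a, b}"
  shows "\<exists>\<P>. decomposition V E \<P> \<and> e \<notin> multicut (E \<union> F) \<P> \<and>
           (\<exists>B\<in>\<P>. a \<in> B \<and> b \<in> B) \<noteq> (\<exists>B\<in>\<P>. c \<in> B \<and> d \<in> B)"
proof (rule ccontr)
  assume *: "\<not> ?thesis"
  have "(axis {a, b} 1 - axis {c, d} 1 :: real ^ 'v set) $ {a, b} = 0"
  proof (rule facet_equation_trivial[OF con H e facet])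
    fix \<P> assume P: "decomposition V E \<P>" "e \<notin> multicut (E \<union> F) \<P>"
    have "(\<exists>B\<in>\<P>. a \<in> B \<and> b \<in> B) = (\<exists>B\<in>\<P>. c \<in> B \<and> d \<in> B)"
      by (rule ccontr) (rule notE[OF *], rule exI, rule conjI[OF P(1) conjI[OF P(2)]])
    then show "(axis {a, b} 1 - axis {c, d} 1) \<bullet> char_vec (multicut (E \<union> F) \<P>) = 0"
      by (simp add: inner_diff_left inner_axis' char_vec_multicut_nth[OF P(1) H ab(1)]
          char_vec_multicut_nth[OF P(1) H cd(1)])
  qed (use ab in auto)
  then show False using cd(2) by (simp add: axis_def)
qed

lemma facet_uncut_block:
  assumes "e = {u, v}" "decomposition V E \<P>" "e \<notin> multicut (E \<union> F) \<P>"
  obtains B where "B \<in> \<P>" "u \<in> B" "v \<in> B"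
proof -
  have uv: "{u, v} \<in> E \<union> F" using e assms(1) by simp
  then have "u \<in> V" "v \<in> V" using subsetD[OF H uv] by simp_all
  moreover have "partition_on V \<P>" using assms(2) by (simp add: decomposition_def)
  ultimately show thesis
    using that edge_in_multicut_iff[of V \<P> u v "E \<union> F"] uv assms(1,3) by blast
qed

text \<open>While \<open>u\<close> and \<open>v\<close> share a block, a third node \<open>w\<close>
  is joined to both or to neither, so the other two sides have equal coordinates on the
  face.\<close>

lemma facet_not_in_triangle: "\<not> in_triangle (E \<union> F) e"
proof
  assume "in_triangle (E \<union> F) e"
  then obtain a b c where t: "is_triangle (E \<union> F) a b c" "e \<in> {{a, b}, {b, c}, {a, c}}"
    unfolding in_triangle_def by blast
  then have "is_triangle (E \<union> F) b c a" "is_triangle (E \<union> F) a c b"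
    by (auto simp: is_triangle_def insert_commute)
  with t obtain u v w where uv: "is_triangle (E \<union> F) u v w" "e = {u, v}" by blast
  then have uw: "{u, w} \<in> E \<union> F" "{u, w} \<noteq> e" and vw: "{v, w} \<in> E \<union> F" "{v, w} \<noteq> {u, w}"
    by (auto simp: is_triangle_def doubleton_eq_iff)
  obtain \<P> where P: "decomposition V E \<P>" "e \<notin> multicut (E \<union> F) \<P>"
      "(\<exists>B\<in>\<P>. u \<in> B \<and> w \<in> B) \<noteq> (\<exists>B\<in>\<P>. v \<in> B \<and> w \<in> B)"
    using facet_distinguishes_edges[OF uw vw] by (elim exE conjE)
  obtain B where "B \<in> \<P>" "u \<in> B" "v \<in> B" using facet_uncut_block[OF uv(2) P(1,2)] .
  then show False
    using P(3) same_block_trans[OF P(1), of u v w] same_block_trans[OF P(1), of v u w] by blast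
qed

text \<open>The block that contains \<open>u\<close> and \<open>v\<close> is connected in \<open>G\<close>, so it meets every \<open>uv\<close>-separating set.\<close>

lemma cut_nodes_same_block:
  assumes "e = {u, v}" "decomposition V E \<P>" "e \<notin> multicut (E \<union> F) \<P>"
    and "cut_node V E u v s" "cut_node V E u v t"
  shows "\<exists>B\<in>\<P>. s \<in> B \<and> t \<in> B"
proof -
  obtain B where B: "B \<in> \<P>" "u \<in> B" "v \<in> B" using facet_uncut_block[OF assms(1-3)] .
  then show ?thesis
    using separating_meets_block[OF assms(2) _ B] assms(4,5) unfolding cut_node_def by blast
qed

text \<open>On the face, \<open>s\<close> and \<open>t\<close> share a block. At distance 1 the
  coordinate of \<open>{s, t}\<close> would vanish; at distance 2 via \<open>w\<close>, those of
  \<open>{s, w}\<close> and \<open>{w, t}\<close> would agree.\<close>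

lemma facet_cut_node_dist:
  assumes uv: "e = {u, v}" and s: "cut_node V E u v s" and t: "cut_node V E u v t"
    and st: "s \<noteq> t" "{s, t} \<noteq> {u, v}"
  shows "3 \<le> graph_dist V (E \<union> F) s t"
  unfolding graph_dist_def
proof (rule Inf_greatest)
  have same: "\<exists>B\<in>\<P>. s \<in> B \<and> t \<in> B" if "decomposition V E \<P>" "e \<notin> multicut (E \<union> F) \<P>" for \<P>
    using cut_nodes_same_block[OF uv that s t] .
  fix x assume "x \<in> {enat (length p - 1) | p. is_path V (E \<union> F) s t p}"
  then obtain p where p: "is_path V (E \<union> F) s t p" "x = enat (length p - 1)" by blast
  \<comment> \<open>\<open>length p\<close> counts nodes, so distance at least 3 means at least four
    nodes.\<close>
  have "length p \<noteq> 0" "length p \<noteq> 1"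
    using p(1) st by (auto simp: is_path_def length_Suc_conv)
  moreover have "length p \<noteq> 2"
  proof
    assume "length p = 2"
    then have "{s, t} \<in> E \<union> F"
      using p(1) by (auto simp: is_path_def length_Suc_conv numeral_2_eq_2)
    then show False using facet_cuts_other_edge[of s t] same st uv by blast
  qed
  moreover have "length p \<noteq> 3"
  proof
    assume "length p = 3"
    then obtain x1 w x3 where "p = [x1, w, x3]"
      by (auto simp: length_Suc_conv numeral_3_eq_3)
    then have w: "{s, w} \<in> E \<union> F" "{w, t} \<in> E \<union> F"
      using p(1) by (auto simp: is_path_def)
    have ne: "{s, w} \<noteq> {w, t}" using st by (auto simp: doubleton_eq_iff)
    have eqv: "(\<exists>B\<in>\<P>. s \<in> B \<and> w \<in> B) = (\<exists>B\<in>\<P>. w \<in> B \<and> t \<in> B)"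
      if "decomposition V E \<P>" "e \<notin> multicut (E \<union> F) \<P>" for \<P>
      using same[OF that] same_block_trans[OF that(1), of s t w] same_block_trans[OF that(1), of w s t]
      by blast
    \<comment> \<open>One of the two edges may be \<open>e\<close>; the other then supplies the
      coefficient for the contradiction.\<close>
    have "{s, w} \<noteq> e \<or> {w, t} \<noteq> e" using ne by blast
    then show False
    proof
      assume "{s, w} \<noteq> e"
      from facet_distinguishes_edges[OF w(1) this w(2) ne[symmetric]] obtain \<P>
        where P: "decomposition V E \<P>" "e \<notin> multicut (E \<union> F) \<P>"
          "(\<exists>B\<in>\<P>. s \<in> B \<and> w \<in> B) \<noteq> (\<exists>B\<in>\<P>. w \<in> B \<and> t \<in> B)"
        by (elim exE conjE)
      from P(3) eqv[OF P(1,2)] show False by (rule notE)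
    next
      assume "{w, t} \<noteq> e"
      from facet_distinguishes_edges[OF w(2) this w(1) ne] obtain \<P>
        where P: "decomposition V E \<P>" "e \<notin> multicut (E \<union> F) \<P>"
          "(\<exists>B\<in>\<P>. w \<in> B \<and> t \<in> B) \<noteq> (\<exists>B\<in>\<P>. s \<in> B \<and> w \<in> B)"
        by (elim exE conjE)
      from P(3) eqv[OF P(1,2), symmetric] show False by (rule notE)
    qed
  qed
  ultimately have "3 \<le> length p - 1" by linarith
  then show "3 \<le> x" using p(2) by (simp add: numeral_eq_enat)
qed

text \<open>The block of \<open>u\<close> and \<open>v\<close> contains \<open>t\<close> and at
  least one of \<open>s\<close>, \<open>s'\<close>. If it contains both, all three sides are uncut;
  otherwise \<open>{s, s'}\<close> and exactly one side at \<open>t\<close> are cut. Hence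
  \<open>?c\<close> gives an equation on the face.\<close>

lemma facet_no_separating_triangle:
  assumes uv: "e = {u, v}" and tri: "is_triangle (E \<union> F) s s' t"
    and sep: "separating V E u v {s, s'}" and t: "cut_node V E u v t"
  shows False
proof -
  let ?c = "axis {s, t} 1 + axis {s', t} 1 - axis {s, s'} 1 :: real ^ 'v set"
  have edges: "{s, t} \<in> E \<union> F" "{s', t} \<in> E \<union> F" "{s, s'} \<in> E \<union> F"
    and ne: "s \<noteq> s'" "s' \<noteq> t" "s \<noteq> t"
    using tri by (auto simp: is_triangle_def)
  have "?c $ f = 0" if "f \<in> E \<union> F" "f \<noteq> e" for f
  proof (rule facet_equation_trivial[OF con H e facet _ that])
    fix \<P> assume P: "decomposition V E \<P>" "e \<notin> multicut (E \<union> F) \<P>"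
    obtain B where B: "B \<in> \<P>" "u \<in> B" "v \<in> B" using facet_uncut_block[OF uv P] .
    have tB: "t \<in> B" and ss: "s \<in> B \<or> s' \<in> B"
      using separating_meets_block[OF P(1) _ B] t sep unfolding cut_node_def by blast+
    have "(\<exists>C\<in>\<P>. x \<in> C \<and> y \<in> C) \<longleftrightarrow> y \<in> B" if "x \<in> B" for x y
      using P(1) B(1) that unfolding decomposition_def partition_on_def disjoint_def by blast
    then have same: "(\<exists>C\<in>\<P>. x \<in> C \<and> y \<in> C) \<longleftrightarrow> x \<in> B \<and> y \<in> B" if "x \<in> B \<or> y \<in> B" for x y
      using that by blast
    show "?c \<bullet> char_vec (multicut (E \<union> F) \<P>) = 0"
      using tB ss
      by (auto simp: inner_add_left inner_diff_left inner_axis'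
          char_vec_multicut_nth[OF P(1) H edges(1)] char_vec_multicut_nth[OF P(1) H edges(2)]
          char_vec_multicut_nth[OF P(1) H edges(3)] same)
  qed
  \<comment> \<open>At least one of the two sides at \<open>t\<close> differs from \<open>e\<close>,
    and its coefficient in \<open>?c\<close> is 1.\<close>
  from this[of "{s, t}"] this[of "{s', t}"] edges ne show False
    by (auto simp: axis_def doubleton_eq_iff split: if_splits)
qed

end

theorem theorem5p7:
  fixes V :: "'v::finite set" and E F :: "'v set set" and e :: "'v set"
  assumes "simple_graph V E" and "connected_graph V E"
    and "F \<subseteq> nsets V 2 - E"
    and "e \<in> E \<union> F"
  shows "(e \<in> E \<longrightarrow>
            (defines_facet (\<lambda>x. 0) (\<lambda>x. x $ e) (LMC V E F) \<longleftrightarrow> \<not> in_triangle (E \<union> F) e)) \<and>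
         (\<forall>u v. e = {u, v} \<and> e \<in> F \<longrightarrow>
            defines_facet (\<lambda>x. 0) (\<lambda>x. x $ e) (LMC V E F) \<longrightarrow>
              \<not> in_triangle (E \<union> F) e \<and>
              (\<forall>s t. cut_node V E u v s \<and> cut_node V E u v t \<and> s \<noteq> t \<and> {s, t} \<noteq> {u, v} \<longrightarrow>
                 3 \<le> graph_dist V (E \<union> F) s t) \<and>
              (\<nexists>s s' t. is_triangle (E \<union> F) s s' t \<and>
                 separating V E u v {s, s'} \<and> cut_node V E u v t))"
proof -
  have H: "E \<union> F \<subseteq> nsets V 2" using assms(1,3) by (auto simp: simple_graph_def)
  note nec = assms(2) H assms(4)
  show ?thesis
  proof (intro conjI impI allI iffI)
    assume "e \<in> E" "\<not> in_triangle (E \<union> F) e"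
    then show "defines_facet (\<lambda>x. 0) (\<lambda>x. x $ e) (LMC V E F)"
      by (rule facet_if_no_triangle[OF assms(2) H])
  next
    fix u v s t
    assume "e = {u, v} \<and> e \<in> F"
      and facet: "defines_facet (\<lambda>x. 0) (\<lambda>x. x $ e) (LMC V E F)"
      and "cut_node V E u v s \<and> cut_node V E u v t \<and> s \<noteq> t \<and> {s, t} \<noteq> {u, v}"
    then show "3 \<le> graph_dist V (E \<union> F) s t"
      using facet_cut_node_dist[OF nec facet, of u v s t] by simp
  next
    fix u v
    assume "e = {u, v} \<and> e \<in> F"
      and facet: "defines_facet (\<lambda>x. 0) (\<lambda>x. x $ e) (LMC V E F)"
    then show "\<nexists>s s' t. is_triangle (E \<union> F) s s' t \<and>
        separating V E u v {s, s'} \<and> cut_node V E u v t"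
      using facet_no_separating_triangle[OF nec facet, of u v] by blast
  \<comment> \<open>What remains is the absence of triangles, once for \<open>e \<in> E\<close> and
    once for \<open>e \<in> F\<close>.\<close>
  qed (rule facet_not_in_triangle[OF nec], assumption)+
qed

end
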